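(* Let $n\ge 1$ be an integer, let $V_{n+3}$ be a complex vector space of dimension $n+3$, and fix a decomposition $V_{n+3}=V_{n+2}\oplus\langle v_{n+3}\rangle$ with $\dim V_{n+2}=n+2$. Let $H_{n+2}\subset\wedge^2V_{n+3}^*$ be a generic $(n+2)$-dimensional subspace, let $X\subset G(2,V_{n+3})$ be the linear section of codimension $n+2$ (smooth, by genericity) cut out by $H_{n+2}$, and let $\omega$ be the morphism associated with $H_{n+2}$ and the decomposition (as defined in the context), with associated subvariety $Y_\omega\subset G(2,V_{n+2})$. Then $X\subset G(2,V_{n+3})$ and $Y_\omega\subset G(2,V_{n+2})$ are projectively equivalent.
   Context: All varieties are over $\mathbb{C}$. $G(2,V)$ is the Grassmannian of $2$-dimensional subspaces (planes) of $V$, in its Plücker embedding $G(2,V)\subset\mathbb{P}(\wedge^2V)$, $\langle a,b\rangle\mapsto[a\wedge b]$, where $\mathbb{P}(\cdot)$ denotes the projective space of lines. "Generic" means: for all $H_{n+2}$ in some nonempty Zariski open subset of the Grassmannian $G(n+2,\wedge^2V_{n+3}^* )$. The linear section cut out by $H_{n+2}$ is $X=G(2,V_{n+3})\cap\mathbb{P}(H_{n+2}^\perp)$, where $H_{n+2}^\perp\subset\wedge^2V_{n+3}$ is the common kernel of the linear forms in $H_{n+2}$. Definition of $\omega$: let $v_{n+3}^*\in V_{n+3}^*$ be the linear form with kernel $V_{n+2}$ and $v_{n+3}^*(v_{n+3})=1$, and regard $V_{n+2}^*$ as the forms on $V_{n+3}$ vanishing on $v_{n+3}$. There is a decomposition $\wedge^2V_{n+3}^*=\wedge^2V_{n+2}^*\oplus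 v_{n+3}^*\wedge V_{n+2}^*$. For generic $H_{n+2}$ the projection to the second summand induces an isomorphism $H_{n+2}\simeq V_{n+2}^*$, so there is a unique linear map $\omega\in\mathrm{Hom}(V_{n+2}^*,\wedge^2V_{n+2}^* )$ (generically a monomorphism) with $$H_{n+2}=\{\omega(u)+v_{n+3}^*\wedge u,\ u\in V_{n+2}^*\}.$$ The same letter $\omega$ denotes the transpose $\omega\in\mathrm{Hom}(\wedge^2V_{n+2},V_{n+2})$, i.e. $\omega(a,b)\in V_{n+2}$ is the vector with $u(\omega(a,b))=\omega(u)(a,b)$ for all $u\in V_{n+2}^*$. Definition of $Y_\omega$: for $\omega\in\mathrm{Hom}(\wedge^2V_{n+2},V_{n+2})$, $$Y_\omega=\{\langle a,b\rangle\in G(2,V_{n+2}):\ \omega(a,b)\in\langle a,b\rangle\}.$$ Equivalently, $Y_\omega$ is the zero locus of the global section of $Q(1)=\mathrm{Hom}(\wedge^2U,Q)$ induced by $\omega$, where $U$ and $Q$ are the tautological rank $2$ bundle and the quotient bundle on $G(2,V_{n+2})$ and $\mathcal{O}(1)=\det U^*$. "Projectively equivalent" means that there is a linear isomorphism of projective spaces $\mathbb{P}(H_{n+2}^\perp)\simeq\mathbb{P}(\wedge^2V_{n+2})$ mapping $X$ isomorphically onto $Y_\omega$ (the two spaces have the same dimension). *)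

theory Defs
  imports
    Complex_Main
    "HOL-Library.Function_Algebras"
    "HOL-Library.FuncSet"
    "Jordan_Normal_Form.Determinant"
begin

text \<open>Complex vector spaces, set up as the library sets up \<^class>\<open>real_vector\<close>.
  Functions into a complex vector space form a complex vector space pointwise; spaces of linear
  forms, of bilinear forms and of bivectors are subspaces of such function types.\<close>

class complex_vector = ab_group_add +
  fixes scaleC :: "complex \<Rightarrow> 'a \<Rightarrow> 'a" (infixr \<open>*\<^sub>C\<close> 75)
  assumes scaleC_add_right: "a *\<^sub>C (x + y) = a *\<^sub>C x + a *\<^sub>C y"
    and scaleC_add_left: "(a + b) *\<^sub>C x = a *\<^sub>C x + b *\<^sub>C x"
    and scaleC_scaleC: "a *\<^sub>C b *\<^sub>C x = (a * b) *\<^sub>C x"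
    and scaleC_one: "1 *\<^sub>C x = x"

global_interpretation cvs: vector_space "scaleC :: complex \<Rightarrow> 'a \<Rightarrow> 'a::complex_vector"
  by unfold_locales (simp_all add: scaleC_add_right scaleC_add_left scaleC_scaleC scaleC_one)

instantiation complex :: complex_vector
begin

definition scaleC_complex :: "complex \<Rightarrow> complex \<Rightarrow> complex"
  where "scaleC_complex c z = c * z"

instance
  by standard (simp_all add: scaleC_complex_def algebra_simps)

end

instantiation "fun" :: (type, complex_vector) complex_vector
begin

definition scaleC_fun :: "complex \<Rightarrow> ('a \<Rightarrow> 'b) \<Rightarrow> 'a \<Rightarrow> 'b"
  where "scaleC_fun c f = (\<lambda>x. c *\<^sub>C f x)"

instance
  by standard
    (simp_all add: scaleC_fun_def fun_eq_iff scaleC_add_right scaleC_add_left scaleC_scaleC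
      scaleC_one)

end

definition linear_on ::
    "'a::complex_vector set \<Rightarrow> 'b::complex_vector set \<Rightarrow> ('a \<Rightarrow> 'b) \<Rightarrow> bool"
  where "linear_on A B f \<longleftrightarrow>
    (\<forall>x\<in>A. f x \<in> B) \<and> (\<forall>x\<in>A. \<forall>y\<in>A. f (x + y) = f x + f y) \<and>
    (\<forall>c. \<forall>x\<in>A. f (c *\<^sub>C x) = c *\<^sub>C f x)"

definition dual :: "('v::complex_vector \<Rightarrow> complex) set"
  where "dual = {f. Vector_Spaces.linear scaleC scaleC f}"

text \<open>For \<open>V = W \<oplus> \<langle>v\<rangle>\<close>, the dual of \<open>W\<close> is regarded as the space of forms on \<open>V\<close> vanishing
  on \<open>v\<close>.\<close>

definition dual_vanishing :: "'v::complex_vector \<Rightarrow> ('v \<Rightarrow> complex) set"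
  where "dual_vanishing v = {u \<in> dual. u v = 0}"

text \<open>Bivectors of the dual are realised as alternating bilinear forms.\<close>

definition form_wedge :: "('v \<Rightarrow> complex) \<Rightarrow> ('v \<Rightarrow> complex) \<Rightarrow> 'v \<Rightarrow> 'v \<Rightarrow> complex"
  where "form_wedge f g = (\<lambda>a b. f a * g b - f b * g a)"

definition ext2_forms :: "('v::complex_vector \<Rightarrow> complex) set \<Rightarrow> ('v \<Rightarrow> 'v \<Rightarrow> complex) set"
  where "ext2_forms L = cvs.span {form_wedge f g | f g. f \<in> L \<and> g \<in> L}"

text \<open>Bivectors of \<open>V\<close> itself are realised as linear functionals on \<open>ext2_forms dual\<close>, so that the
  pairing of a bivector with an alternating form is application. The value \<open>0\<close> outside
  \<open>ext2_forms dual\<close> only makes the representing function unique.\<close>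

definition vec_wedge ::
    "'v::complex_vector \<Rightarrow> 'v \<Rightarrow> ('v \<Rightarrow> 'v \<Rightarrow> complex) \<Rightarrow> complex"
  where "vec_wedge a b = (\<lambda>h. if h \<in> ext2_forms dual then h a b else 0)"

definition ext2 ::
    "'v::complex_vector set \<Rightarrow> (('v \<Rightarrow> 'v \<Rightarrow> complex) \<Rightarrow> complex) set"
  where "ext2 S = cvs.span {vec_wedge a b | a b. a \<in> S \<and> b \<in> S}"

definition gr :: "nat \<Rightarrow> 'a::complex_vector set \<Rightarrow> 'a set set"
  where "gr k S = {L. cvs.subspace L \<and> L \<subseteq> S \<and> cvs.dim L = k}"

abbreviation proj_space :: "'a::complex_vector set \<Rightarrow> 'a set set"
  where "proj_space S \<equiv> gr 1 S"

text \<open>The image of a set of planes under the Pluecker embedding \<open>\<langle>a,b\<rangle> \<mapsto> [a \<and> b]\<close>.\<close>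

definition pluecker ::
    "'v::complex_vector set set \<Rightarrow> (('v \<Rightarrow> 'v \<Rightarrow> complex) \<Rightarrow> complex) set set"
  where "pluecker P = {cvs.span {vec_wedge a b} | a b. cvs.span {a, b} \<in> P}"

text \<open>Zariski topology on the Grassmannian \<open>gr k S\<close>, induced from its Pluecker embedding in the
  projective space of the \<open>k\<close>-th exterior power. A linear coordinate on that exterior power is a
  linear combination of functionals \<open>f\<^sub>0 \<and> \<dots> \<and> f\<^sub>k\<^sub>-\<^sub>1\<close> with the \<open>f\<^sub>i\<close> linear forms, whose
  value on \<open>w\<^sub>0 \<and> \<dots> \<and> w\<^sub>k\<^sub>-\<^sub>1\<close> is the determinant of the \<open>f\<^sub>i (w\<^sub>j)\<close>.
  \<open>hom_pluecker k d\<close> consists of the homogeneous polynomials of degree \<open>d\<close> in these coordinates,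
  as functions of the frame \<open>w\<close> (only \<open>w 0, \<dots>, w (k - 1)\<close> matter). Change of frame multiplies
  such a function by the \<open>d\<close>-th power of a nonzero number.\<close>

inductive_set hom_pluecker :: "nat \<Rightarrow> (nat \<times> ((nat \<Rightarrow> 'a::complex_vector) \<Rightarrow> complex)) set"
  for k :: nat where
  const: "(0, \<lambda>w. c) \<in> hom_pluecker k"
| coord: "(\<And>i. i < k \<Longrightarrow> f i \<in> dual) \<Longrightarrow>
    (1, \<lambda>w. det (mat k k (\<lambda>(i, j). f i (w j)))) \<in> hom_pluecker k"
| add: "(d, p) \<in> hom_pluecker k \<Longrightarrow> (d, q) \<in> hom_pluecker k \<Longrightarrow>
    (d, \<lambda>w. p w + q w) \<in> hom_pluecker k"
| mult: "(d, p) \<in> hom_pluecker k \<Longrightarrow> (e, q) \<in> hom_pluecker k \<Longrightarrow>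
    (d + e, \<lambda>w. p w * q w) \<in> hom_pluecker k"

definition zariski_closed :: "nat \<Rightarrow> 'a::complex_vector set \<Rightarrow> 'a set set \<Rightarrow> bool"
  where "zariski_closed k S C \<longleftrightarrow>
    (\<exists>F \<subseteq> hom_pluecker k.
       C = {L \<in> gr k S. \<forall>(d, p) \<in> F. \<forall>w. cvs.span (w ` {..<k}) = L \<longrightarrow> p w = 0})"

definition zariski_open :: "nat \<Rightarrow> 'a::complex_vector set \<Rightarrow> 'a set set \<Rightarrow> bool"
  where "zariski_open k S U \<longleftrightarrow> U \<subseteq> gr k S \<and> zariski_closed k S (gr k S - U)"

definition perp ::
    "('v::complex_vector \<Rightarrow> 'v \<Rightarrow> complex) set \<Rightarrow> (('v \<Rightarrow> 'v \<Rightarrow> complex) \<Rightarrow> complex) set"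
  where "perp H = {\<theta> \<in> ext2 UNIV. \<forall>h\<in>H. \<theta> h = 0}"

definition linear_section ::
    "('v::complex_vector \<Rightarrow> 'v \<Rightarrow> complex) set \<Rightarrow> (('v \<Rightarrow> 'v \<Rightarrow> complex) \<Rightarrow> complex) set set"
  where "linear_section H = pluecker (gr 2 UNIV) \<inter> proj_space (perp H)"

text \<open>\<open>assoc_morphism v vstar H \<omega>\<close>: \<open>\<omega>\<close> is a linear map from the dual of \<open>W\<close> to its exterior square
  with \<open>H = {\<omega>(u) + v* \<and> u}\<close>. The extensionality condition makes \<open>\<omega>\<close> determined by its values on
  the dual of \<open>W\<close>.\<close>

definition assoc_morphism ::
    "'v::complex_vector \<Rightarrow> ('v \<Rightarrow> complex) \<Rightarrow> ('v \<Rightarrow> 'v \<Rightarrow> complex) set \<Rightarrow>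
     (('v \<Rightarrow> complex) \<Rightarrow> 'v \<Rightarrow> 'v \<Rightarrow> complex) \<Rightarrow> bool"
  where "assoc_morphism v vstar H \<omega> \<longleftrightarrow>
    \<omega> \<in> extensional (dual_vanishing v) \<and>
    linear_on (dual_vanishing v) (ext2_forms (dual_vanishing v)) \<omega> \<and>
    H = {\<omega> u + form_wedge vstar u | u. u \<in> dual_vanishing v}"

text \<open>The transpose of \<open>\<omega>\<close>, a linear map from \<open>ext2 W\<close> to \<open>W\<close>.\<close>

definition transpose_morphism ::
    "'v::complex_vector set \<Rightarrow> 'v \<Rightarrow> (('v \<Rightarrow> complex) \<Rightarrow> 'v \<Rightarrow> 'v \<Rightarrow> complex) \<Rightarrow>
     (('v \<Rightarrow> 'v \<Rightarrow> complex) \<Rightarrow> complex) \<Rightarrow> 'v"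
  where "transpose_morphism W v \<omega> \<theta> =
    (THE x. x \<in> W \<and> (\<forall>u \<in> dual_vanishing v. u x = \<theta> (\<omega> u)))"

text \<open>The condition defining \<open>Y\<close> does not depend on the basis \<open>a, b\<close> of the plane.\<close>

definition Y_planes ::
    "'v::complex_vector set \<Rightarrow> ((('v \<Rightarrow> 'v \<Rightarrow> complex) \<Rightarrow> complex) \<Rightarrow> 'v) \<Rightarrow> 'v set set"
  where "Y_planes W \<phi> =
    {L \<in> gr 2 W. \<exists>a b. L = cvs.span {a, b} \<and> \<phi> (vec_wedge a b) \<in> L}"

text \<open>\<open>X\<close> and \<open>Y\<close> are sets of points of the projective spaces of \<open>A\<close> and \<open>B\<close>. A linear
  isomorphism of the ambient projective spaces carrying \<open>X\<close> onto \<open>Y\<close> restricts to an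
  isomorphism of varieties.\<close>

definition projectively_equivalent ::
    "'a::complex_vector set \<Rightarrow> 'a set set \<Rightarrow> 'b::complex_vector set \<Rightarrow> 'b set set \<Rightarrow> bool"
  where "projectively_equivalent A X B Y \<longleftrightarrow>
    (\<exists>\<phi>. linear_on A B \<phi> \<and> bij_betw \<phi> A B \<and> (\<lambda>l. \<phi> ` l) ` X = Y)"

end

theory Submission
  imports Defs
begin

text \<open>Write \<open>V = W \<oplus> \<langle>v\<rangle>\<close>. An alternating form \<open>h\<close> on \<open>V\<close> is determined by its restriction to \<open>W\<close>
  and the linear form \<open>h(v, \<cdot>)\<close>, which vanishes on \<open>v\<close>; the projection of \<open>H\<close> to \<open>v* \<and> W*\<close> is
  \<open>h \<mapsto> h(v, \<cdot>)\<close>. It is an isomorphism \<open>H \<rightarrow> W*\<close> exactly when the determinant of the values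
  \<open>h\<^sub>j(v, e\<^sub>i)\<close> is nonzero for a basis \<open>h\<^sub>j\<close> of \<open>H\<close> and a basis \<open>e\<^sub>i\<close> of \<open>W\<close>. This determinant is a
  linear Pluecker coordinate of \<open>H\<close>, so its nonvanishing defines a Zariski open set (\<open>transversal\<close>),
  which contains \<open>v* \<and> W*\<close>. For \<open>H\<close> in this set, \<open>\<omega>\<close> is obtained from the inverse isomorphism
  (\<open>transversal_assoc_morphism_ex1\<close>).

  For every \<open>H\<close> that has an associated \<open>\<omega>\<close>, the equivalence is induced by the projection
  \<open>V \<rightarrow> W\<close> along \<open>v\<close>. A bivector on \<open>V\<close> is uniquely \<open>\<eta> + v \<and> x\<close> with \<open>\<eta>\<close> in the exterior square of
  \<open>W\<close> and \<open>x \<in> W\<close>, and \<open>\<omega>(u) + v* \<and> u\<close> takes the value \<open>u(\<omega>(\<eta>)) + u(x)\<close> on it, where \<open>\<omega>(\<eta>)\<close> is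
  the transpose. Hence the annihilator of \<open>H\<close> consists of the bivectors \<open>\<eta> - v \<and> \<omega>(\<eta>)\<close>, and
  \<open>\<eta> + v \<and> x \<mapsto> \<eta>\<close> maps it isomorphically onto the exterior square of \<open>W\<close> (\<open>bij_push\<close>).
  If \<open>a, b\<close> project to \<open>a', b'\<close> in \<open>W\<close> with \<open>v\<close>-components \<open>s, t\<close>, then
  \<open>a \<and> b = a' \<and> b' - v \<and> (t a' - s b')\<close>, so \<open>a \<and> b\<close> annihilates \<open>H\<close> if and only if
  \<open>\<omega>(a', b') = t a' - s b'\<close> (\<open>wedge_in_perp_iff\<close>). This places \<open>\<langle>a', b'\<rangle>\<close> in \<open>Y\<close>; conversely, the
  coefficients of \<open>\<omega>(a', b')\<close> in the basis \<open>a', b'\<close> are the \<open>v\<close>-components of the vectors spanning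
  the preimage plane.\<close>

section \<open>Linear forms, alternating forms and bivectors\<close>

lemma scaleC_apply [simp]: "(c *\<^sub>C f) x = c *\<^sub>C f x"
  by (simp add: scaleC_fun_def)

lemma scaleC_complex [simp]: "c *\<^sub>C z = c * z" for z :: complex
  by (simp add: scaleC_complex_def)

lemma sum_fun_apply: "(\<Sum>i\<in>A. f i) x = (\<Sum>i\<in>A. f i x)"
  for f :: "'i \<Rightarrow> 'a \<Rightarrow> 'b::comm_monoid_add"
  by (induction A rule: infinite_finite_induct) auto

lemma subspaceI:
  assumes "0 \<in> S" "\<And>x y. x \<in> S \<Longrightarrow> y \<in> S \<Longrightarrow> x + y \<in> S" "\<And>c x. x \<in> S \<Longrightarrow> c *\<^sub>C x \<in> S"
  shows "cvs.subspace S"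
  using assms by (auto simp: cvs.subspace_def)

lemma dual_iff:
  "f \<in> dual \<longleftrightarrow> (\<forall>x y. f (x + y) = f x + f y) \<and> (\<forall>c x. f (c *\<^sub>C x) = c * f x)"
  by (auto simp: dual_def Vector_Spaces.linear_iff cvs.vector_space_axioms)

lemma dual_simps:
  assumes "f \<in> dual"
  shows "f (x + y) = f x + f y" "f (c *\<^sub>C x) = c * f x" "f 0 = 0" "f (- x) = - f x"
    "f (x - y) = f x - f y" "f (\<Sum>i\<in>A. g i) = (\<Sum>i\<in>A. f (g i))"
proof -
  interpret Vector_Spaces.linear "scaleC :: complex \<Rightarrow> 'a \<Rightarrow> 'a" "scaleC :: complex \<Rightarrow> complex \<Rightarrow> complex" f
    using assms by (simp add: dual_def)
  show "f (x + y) = f x + f y" "f (c *\<^sub>C x) = c * f x" "f 0 = 0" "f (- x) = - f x"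
    "f (x - y) = f x - f y" "f (\<Sum>i\<in>A. g i) = (\<Sum>i\<in>A. f (g i))"
    by (simp_all add: add scale neg diff sum)
qed

lemma subspace_dual: "cvs.subspace dual"
  by (intro subspaceI) (auto simp: dual_iff algebra_simps)

lemma dual_vanishing_subset: "dual_vanishing v \<subseteq> dual"
  by (auto simp: dual_vanishing_def)

lemma subspace_dual_vanishing: "cvs.subspace (dual_vanishing v)"
  using subspace_dual by (auto simp: dual_vanishing_def cvs.subspace_def)

lemma ext2_forms_mono: "L \<subseteq> M \<Longrightarrow> ext2_forms L \<subseteq> ext2_forms M"
  unfolding ext2_forms_def by (intro cvs.span_mono) auto

lemma subspace_ext2_forms: "cvs.subspace (ext2_forms L)"
  by (simp add: ext2_forms_def)

lemma form_wedge_in_ext2_forms: "f \<in> L \<Longrightarrow> g \<in> L \<Longrightarrow> form_wedge f g \<in> ext2_forms L"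
  unfolding ext2_forms_def by (intro cvs.span_base) auto

lemma ext2_forms_induct [consumes 1, case_names wedge zero add scale]:
  assumes "h \<in> ext2_forms L"
    and "\<And>f g. f \<in> L \<Longrightarrow> g \<in> L \<Longrightarrow> P (form_wedge f g)"
    and "P 0" "\<And>h h'. P h \<Longrightarrow> P h' \<Longrightarrow> P (h + h')" "\<And>c h. P h \<Longrightarrow> P (c *\<^sub>C h)"
  shows "P h"
  using assms(1) unfolding ext2_forms_def
proof (rule cvs.span_induct)
  show "cvs.subspace (Collect P)"
    by (rule subspaceI; unfold mem_Collect_eq; rule assms(3-5))
qed (use assms(2) in blast)

lemma ext2_forms_dualD:
  assumes "h \<in> ext2_forms dual"
  shows "h a \<in> dual" "h b c = - h c b"
proof -
  show "h a \<in> dual"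
    using assms
  proof (induction rule: ext2_forms_induct)
    case (wedge f g)
    then show ?case by (simp add: form_wedge_def dual_iff algebra_simps)
  qed (simp_all add: dual_iff algebra_simps)
  have "h b c + h c b = 0"
    using assms
  proof (induction rule: ext2_forms_induct)
    case (add h h')
    have "(h + h') b c + (h + h') c b = (h b c + h c b) + (h' b c + h' c b)" by simp
    with add show ?case by simp
  next
    case (scale d h)
    have "(d *\<^sub>C h) b c + (d *\<^sub>C h) c b = d * (h b c + h c b)"
      by (simp add: distrib_left)
    with scale show ?case by simp
  qed (simp_all add: form_wedge_def)
  then show "h b c = - h c b" by (simp only: eq_neg_iff_add_eq_0)
qed

lemma ext2_forms_bilinear:
  assumes "h \<in> ext2_forms dual"
  shows "h a (b + b') = h a b + h a b'" "h a (c *\<^sub>C b) = c * h a b"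
    "h (a + a') b = h a b + h a' b" "h (c *\<^sub>C a) b = c * h a b" "h a a = 0"
    "h 0 b = 0" "h a 0 = 0"
proof -
  note d = ext2_forms_dualD[OF assms] and s = dual_simps[OF ext2_forms_dualD(1)[OF assms]]
  show "h a (b + b') = h a b + h a b'" "h a (c *\<^sub>C b) = c * h a b" "h a 0 = 0"
    by (simp_all add: s)
  show "h (a + a') b = h a b + h a' b" "h (c *\<^sub>C a) b = c * h a b" "h 0 b = 0"
    unfolding d(2)[of "a + a'" b] d(2)[of "c *\<^sub>C a" b] d(2)[of 0 b] d(2)[of a b] d(2)[of a' b]
    by (simp_all add: s)
  show "h a a = 0" using d(2)[of a a] by simp
qed

lemma vec_wedge_bilinear:
  "vec_wedge a (b + b') = vec_wedge a b + vec_wedge a b'"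
  "vec_wedge a (c *\<^sub>C b) = c *\<^sub>C vec_wedge a b"
  "vec_wedge (a + a') b = vec_wedge a b + vec_wedge a' b"
  "vec_wedge (c *\<^sub>C a) b = c *\<^sub>C vec_wedge a b"
  "vec_wedge a a = 0"
  "vec_wedge a b = - vec_wedge b a"
  "vec_wedge 0 b = 0" "vec_wedge a 0 = 0"
proof -
  show "vec_wedge a b = - vec_wedge b a"
  proof
    fix h show "vec_wedge a b h = (- vec_wedge b a) h"
      using ext2_forms_dualD(2)[of h a b] by (simp add: vec_wedge_def)
  qed
qed (auto simp: vec_wedge_def fun_eq_iff ext2_forms_bilinear)

lemma vec_wedge_minus_right: "vec_wedge a (- b) = - vec_wedge a b"
  using vec_wedge_bilinear(2)[of a "- 1" b] by (simp only: cvs.scale_minus_left cvs.scale_one)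

lemma ext2_mono: "S \<subseteq> T \<Longrightarrow> ext2 S \<subseteq> ext2 T"
  unfolding ext2_def by (intro cvs.span_mono) auto

lemma subspace_ext2: "cvs.subspace (ext2 S)"
  by (simp add: ext2_def)

lemma vec_wedge_in_ext2: "a \<in> S \<Longrightarrow> b \<in> S \<Longrightarrow> vec_wedge a b \<in> ext2 S"
  unfolding ext2_def by (intro cvs.span_base) auto

lemma ext2_induct [consumes 1, case_names wedge zero add scale]:
  assumes "\<theta> \<in> ext2 S"
    and "\<And>a b. a \<in> S \<Longrightarrow> b \<in> S \<Longrightarrow> P (vec_wedge a b)"
    and "P 0" "\<And>\<theta> \<theta>'. P \<theta> \<Longrightarrow> P \<theta>' \<Longrightarrow> P (\<theta> + \<theta>')" "\<And>c \<theta>. P \<theta> \<Longrightarrow> P (c *\<^sub>C \<theta>)"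
  shows "P \<theta>"
  using assms(1) unfolding ext2_def
proof (rule cvs.span_induct)
  show "cvs.subspace (Collect P)"
    by (rule subspaceI; unfold mem_Collect_eq; rule assms(3-5))
qed (use assms(2) in blast)

text \<open>Bivectors are functionals on all functions of two variables, but they are linear only
  on the alternating forms.\<close>

lemma ext2_linear:
  assumes "\<theta> \<in> ext2 S"
  shows "h \<in> ext2_forms dual \<Longrightarrow> h' \<in> ext2_forms dual \<Longrightarrow> \<theta> (h + h') = \<theta> h + \<theta> h'"
    and "h \<in> ext2_forms dual \<Longrightarrow> \<theta> (c *\<^sub>C h) = c * \<theta> h"
proof -
  show "\<theta> (h + h') = \<theta> h + \<theta> h'" if "h \<in> ext2_forms dual" "h' \<in> ext2_forms dual"
    using assms that
    by (induction rule: ext2_induct)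
      (auto simp: vec_wedge_def algebra_simps cvs.subspace_add[OF subspace_ext2_forms])
  show "\<theta> (c *\<^sub>C h) = c * \<theta> h" if "h \<in> ext2_forms dual"
    using assms that
    by (induction rule: ext2_induct)
      (auto simp: vec_wedge_def algebra_simps cvs.subspace_scale[OF subspace_ext2_forms])
qed

lemma ext2_sum:
  assumes "\<theta> \<in> ext2 S" "\<And>i. i \<in> A \<Longrightarrow> h i \<in> ext2_forms dual"
  shows "\<theta> (\<Sum>i\<in>A. c i *\<^sub>C h i) = (\<Sum>i\<in>A. c i * \<theta> (h i))"
  using assms(2)
proof (induction A rule: infinite_finite_induct)
  case (insert x F)
  have "(\<Sum>i\<in>F. c i *\<^sub>C h i) \<in> ext2_forms dual"
    using insert by (intro cvs.subspace_sum[OF subspace_ext2_forms] cvs.subspace_scale[OF subspace_ext2_forms]) auto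
  moreover have "c x *\<^sub>C h x \<in> ext2_forms dual"
    using insert by (intro cvs.subspace_scale[OF subspace_ext2_forms]) auto
  ultimately have "\<theta> (c x *\<^sub>C h x + (\<Sum>i\<in>F. c i *\<^sub>C h i)) = c x * \<theta> (h x) + \<theta> (\<Sum>i\<in>F. c i *\<^sub>C h i)"
    using insert by (simp only: ext2_linear[OF assms(1)] insertI1)
  then show ?case
    using insert by (simp only: sum.insert insert_iff simp_thms)
qed (use ext2_linear(2)[OF assms(1), of 0 0] cvs.subspace_0[OF subspace_ext2_forms] in auto)

lemma wedge_in_span_wedge:
  assumes "x \<in> cvs.span {a, b}" "y \<in> cvs.span {a, b}"
  shows "vec_wedge x y \<in> cvs.span {vec_wedge a b}"
proof -
  obtain p q where x: "x = p *\<^sub>C a + q *\<^sub>C b"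
    using assms(1) by (auto simp: cvs.span_breakdown_eq) (metis add_diff_cancel_left' diff_add_cancel eq_diff_eq)
  obtain r s where y: "y = r *\<^sub>C a + s *\<^sub>C b"
    using assms(2) by (auto simp: cvs.span_breakdown_eq) (metis add_diff_cancel_left' diff_add_cancel eq_diff_eq)
  have "vec_wedge x y = (p * s - q * r) *\<^sub>C vec_wedge a b"
    unfolding x y using vec_wedge_bilinear(6)[of b a]
    by (simp add: vec_wedge_bilinear(1-5) cvs.scale_left_diff_distrib cvs.scale_right_distrib
       mult.commute)
  then show ?thesis by (simp add: cvs.span_base cvs.span_scale)
qed

lemma dim_pair_eq_2_iff: "cvs.dim {a, b} = 2 \<longleftrightarrow> vec_wedge a b \<noteq> 0"
proof (cases "cvs.independent {a, b} \<and> a \<noteq> b")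
  case True
  define B where "B = cvs.extend_basis {a, b}"
  have B: "cvs.independent B" "cvs.span B = UNIV" "a \<in> B" "b \<in> B"
    using True cvs.independent_extend_basis[of "{a, b}"] cvs.span_extend_basis[of "{a, b}"]
      cvs.extend_basis_superset[of "{a, b}"]
    by (auto simp: B_def)
  define f where "f c = (\<lambda>x. cvs.representation B x c)" for c
  have f: "f c \<in> dual" for c
    by (simp add: f_def dual_iff cvs.representation_add[OF B(1)] cvs.representation_scale[OF B(1)] B(2))
  have "form_wedge (f a) (f b) a b = 1"
    using True B by (simp add: form_wedge_def f_def cvs.representation_basis)
  then have "vec_wedge a b (form_wedge (f a) (f b)) = 1"
    by (simp add: vec_wedge_def form_wedge_in_ext2_forms f)
  then have "vec_wedge a b \<noteq> 0" by auto
  moreover have "cvs.dim {a, b} = 2"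
    using True cvs.dim_eq_card_independent[of "{a, b}"] by simp
  ultimately show ?thesis by simp
next
  case False
  have *: "a \<in> cvs.span {b} \<or> b \<in> cvs.span {a}"
    using False cvs.independent_insert[of a "{b}"]
    by (cases "a = b") (auto simp: cvs.span_base cvs.span_zero)
  have "vec_wedge a b = 0"
    using * by (auto simp: cvs.span_breakdown_eq vec_wedge_bilinear(1-5,7,8))
  moreover have "cvs.dim {a, b} \<le> 1"
  proof -
    have "{a, b} \<subseteq> cvs.span {b} \<or> {a, b} \<subseteq> cvs.span {a}"
      using * by (auto simp: cvs.span_base)
    then show ?thesis using cvs.dim_le_card[of "{a, b}" "{b}"] cvs.dim_le_card[of "{a, b}" "{a}"] by auto
  qed
  ultimately show ?thesis by simp
qed


lemma form_wedge_right_linear: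
  "form_wedge f (g + g') = form_wedge f g + form_wedge f g'"
  "form_wedge f (c *\<^sub>C g) = c *\<^sub>C form_wedge f g"
  by (intro ext; simp add: form_wedge_def; simp add: algebra_simps)+

text \<open>The family \<open>w\<close> need not be injective, so the coefficients are indexed by \<open>j < k\<close> and not by
  the elements of the image.\<close>

lemma span_image_sum:
  fixes k :: nat
  assumes "x \<in> cvs.span (w ` {..<k})"
  shows "\<exists>c. x = (\<Sum>j<k. c j *\<^sub>C w j)"
  using assms
proof (rule cvs.span_induct)
  show "cvs.subspace (Collect (\<lambda>x. \<exists>c. x = (\<Sum>j<k. c j *\<^sub>C w j)))"
  proof (rule subspaceI; clarify)
    show "\<exists>c. 0 = (\<Sum>j<k. c j *\<^sub>C w j)"
      by (rule exI[of _ "\<lambda>_. 0"]) simp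
  next
    fix c d
    show "\<exists>c'. (\<Sum>j<k. c j *\<^sub>C w j) + (\<Sum>j<k. d j *\<^sub>C w j) = (\<Sum>j<k. c' j *\<^sub>C w j)"
      by (rule exI[of _ "\<lambda>j. c j + d j"]) (simp only: scaleC_add_left sum.distrib)
  next
    fix a c
    show "\<exists>c'. a *\<^sub>C (\<Sum>j<k. c j *\<^sub>C w j) = (\<Sum>j<k. c' j *\<^sub>C w j)"
      by (rule exI[of _ "\<lambda>j. a * c j"]) (simp only: scaleC_scaleC[symmetric] cvs.scale_sum_right)
  qed
next
  fix x assume "x \<in> w ` {..<k}"
  then obtain i where i: "i < k" "x = w i" by auto
  have "(\<Sum>j<k. (if j = i then 1 else 0) *\<^sub>C w j) = (\<Sum>j<k. if j = i then w j else 0)"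
    by (intro sum.cong refl) (simp only: if_distrib[of "\<lambda>c. c *\<^sub>C _"] cvs.scale_one cvs.scale_zero_left)
  also have "\<dots> = x" using i by (simp only: sum.delta finite_lessThan lessThan_iff if_True)
  finally show "\<exists>c. x = (\<Sum>j<k. c j *\<^sub>C w j)"
    by (intro exI[of _ "\<lambda>j. if j = i then 1 else 0"]) (rule sym)
qed

section \<open>A hyperplane with a complementary line\<close>

text \<open>A hyperplane \<open>W\<close> with basis \<open>e 0, \<dots>, e (k - 1)\<close>, a vector \<open>v\<close> outside \<open>W\<close>, and the linear form
  \<open>vstar\<close> with kernel \<open>W\<close> and value \<open>1\<close> at \<open>v\<close>.\<close>

locale hyperplane_splitting =
  fixes W :: "'v::complex_vector set" and v :: 'v and vstar :: "'v \<Rightarrow> complex"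
    and e :: "nat \<Rightarrow> 'v" and k :: nat
  assumes vstar_dual: "vstar \<in> dual"
    and W_eq: "W = {x. vstar x = 0}"
    and vstar_v: "vstar v = 1"
    and inj_e: "inj_on e {..<k}"
    and indep_e: "cvs.independent (e ` {..<k})"
    and span_e: "cvs.span (e ` {..<k}) = W"
begin

text \<open>The projection to \<open>W\<close> along \<open>v\<close>.\<close>

definition proj :: "'v \<Rightarrow> 'v"
  where "proj x = x - vstar x *\<^sub>C v"

text \<open>The basis of the dual of \<open>W\<close> dual to \<open>e\<close>, as linear forms on the whole space that vanish
  on \<open>v\<close>.\<close>

definition coord :: "nat \<Rightarrow> 'v \<Rightarrow> complex"
  where "coord i x = cvs.representation (e ` {..<k}) (proj x) (e i)"

lemma subspace_W: "cvs.subspace W"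
  using span_e cvs.subspace_span by metis

lemma e_in_W: "i < k \<Longrightarrow> e i \<in> W"
  unfolding span_e[symmetric] by (rule cvs.span_base) simp

lemma proj_linear: "proj (x + y) = proj x + proj y" "proj (c *\<^sub>C x) = c *\<^sub>C proj x"
  by (simp_all add: proj_def dual_simps[OF vstar_dual] scaleC_add_left scaleC_scaleC
      cvs.scale_right_diff_distrib)

lemma proj_in_W: "proj x \<in> W"
  by (simp add: W_eq proj_def dual_simps[OF vstar_dual] vstar_v)

lemma proj_W: "x \<in> W \<Longrightarrow> proj x = x"
  by (simp add: W_eq proj_def)

lemma proj_v: "proj v = 0"
  by (simp add: proj_def vstar_v)

lemma coord_dual_vanishing: "coord i \<in> dual_vanishing v"
proof -
  have "coord i (x + y) = coord i x + coord i y" "coord i (c *\<^sub>C x) = c * coord i x" for x y c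
    unfolding coord_def proj_linear
    using proj_in_W span_e
    by (auto intro!: cvs.representation_add[OF indep_e, THEN fun_cong, THEN trans]
        cvs.representation_scale[OF indep_e, THEN fun_cong, THEN trans])
  then show ?thesis
    by (simp add: dual_vanishing_def dual_iff coord_def proj_v cvs.representation_zero)
qed

lemma coord_e: "i < k \<Longrightarrow> j < k \<Longrightarrow> coord i (e j) = (if i = j then 1 else 0)"
  using inj_e
  by (auto simp: coord_def proj_W e_in_W cvs.representation_basis[OF indep_e] inj_on_eq_iff)

lemma sum_coord: "x \<in> W \<Longrightarrow> x = (\<Sum>i<k. coord i x *\<^sub>C e i)"
proof -
  assume x: "x \<in> W"
  have "(\<Sum>i<k. coord i x *\<^sub>C e i)
      = (\<Sum>b\<in>e ` {..<k}. cvs.representation (e ` {..<k}) x b *\<^sub>C b)"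
    by (simp only: coord_def proj_W[OF x] sum.reindex[OF inj_e] o_def)
  also have "\<dots> = x"
    by (rule cvs.sum_representation_eq[OF indep_e]) (use x span_e in auto)
  finally show "x = (\<Sum>i<k. coord i x *\<^sub>C e i)" by (rule sym)
qed

lemma dual_vanishing_apply:
  assumes "u \<in> dual_vanishing v"
  shows "u x = u (proj x)"
  using assms
  by (simp add: dual_vanishing_def proj_def dual_simps)

lemma dual_vanishing_expand:
  assumes "u \<in> dual_vanishing v"
  shows "u = (\<Sum>i<k. u (e i) *\<^sub>C coord i)"
proof
  fix x
  have u: "u \<in> dual" using assms by (simp add: dual_vanishing_def)
  have "u x = u (\<Sum>i<k. coord i (proj x) *\<^sub>C e i)"
    using dual_vanishing_apply[OF assms] sum_coord[OF proj_in_W] by metis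
  also have "\<dots> = (\<Sum>i<k. coord i (proj x) * u (e i))"
    by (simp add: dual_simps[OF u])
  also have "\<dots> = (\<Sum>i<k. u (e i) *\<^sub>C coord i) x"
    by (simp add: sum_fun_apply mult.commute dual_vanishing_apply[OF coord_dual_vanishing, of _ x])
  finally show "u x = (\<Sum>i<k. u (e i) *\<^sub>C coord i) x" .
qed

lemma dual_vanishing_eqI:
  assumes "u \<in> dual_vanishing v" "u' \<in> dual_vanishing v" "\<And>i. i < k \<Longrightarrow> u (e i) = u' (e i)"
  shows "u = u'"
proof -
  have "u = (\<Sum>i<k. u (e i) *\<^sub>C coord i)" by (rule dual_vanishing_expand[OF assms(1)])
  also have "\<dots> = (\<Sum>i<k. u' (e i) *\<^sub>C coord i)"
    using assms(3) by (intro sum.cong) auto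
  also have "\<dots> = u'" by (rule dual_vanishing_expand[OF assms(2), symmetric])
  finally show ?thesis .
qed

text \<open>The forms vanishing on \<open>v\<close> separate the points of \<open>W\<close>.\<close>

lemma W_eqI:
  assumes "x \<in> W" "y \<in> W" "\<And>u. u \<in> dual_vanishing v \<Longrightarrow> u x = u y"
  shows "x = y"
proof -
  have "x = (\<Sum>i<k. coord i x *\<^sub>C e i)" by (rule sum_coord[OF assms(1)])
  also have "\<dots> = (\<Sum>i<k. coord i y *\<^sub>C e i)"
    by (simp only: assms(3)[OF coord_dual_vanishing])
  also have "\<dots> = y" by (rule sum_coord[OF assms(2), symmetric])
  finally show ?thesis .
qed

lemma form_at_v_dual_vanishing: "h \<in> ext2_forms dual \<Longrightarrow> h v \<in> dual_vanishing v"
  by (simp add: dual_vanishing_def ext2_forms_dualD(1) ext2_forms_bilinear(5))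

lemma form_vanishing_at_v: "h \<in> ext2_forms (dual_vanishing v) \<Longrightarrow> h v = 0"
  by (induction rule: ext2_forms_induct) (auto simp: form_wedge_def dual_vanishing_def fun_eq_iff)

lemma form_wedge_vstar_at_v: "u \<in> dual_vanishing v \<Longrightarrow> form_wedge vstar u v = u"
  by (simp add: form_wedge_def dual_vanishing_def fun_eq_iff vstar_v)

text \<open>The decomposition of an alternating form \<open>h\<close> into a form on \<open>W\<close> and \<open>v* \<and> u\<close>; the linear form
  \<open>u\<close> is \<open>h(v, \<cdot>)\<close>.\<close>

lemma ext2_forms_decomp:
  assumes "h \<in> ext2_forms dual"
  shows "h - form_wedge vstar (h v) \<in> ext2_forms (dual_vanishing v)"
  using assms
proof (induction rule: ext2_forms_induct)
  case (wedge f g)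
  define f' g' where "f' = f - f v *\<^sub>C vstar" and "g' = g - g v *\<^sub>C vstar"
  have "f' \<in> dual_vanishing v" "g' \<in> dual_vanishing v"
    using wedge vstar_dual vstar_v
    by (auto simp: f'_def g'_def dual_vanishing_def
        intro!: cvs.subspace_diff[OF subspace_dual] cvs.subspace_scale[OF subspace_dual])
  moreover have "form_wedge f g - form_wedge vstar (form_wedge f g v) = form_wedge f' g'"
    by (simp add: form_wedge_def fun_eq_iff f'_def g'_def algebra_simps)
  ultimately show ?case by (simp add: form_wedge_in_ext2_forms)
next
  case zero
  have "0 - form_wedge vstar (0 v) = 0" by (simp add: form_wedge_def fun_eq_iff)
  then show ?case by (simp only: cvs.subspace_0[OF subspace_ext2_forms])
next
  case (add h h')
  have "h + h' - form_wedge vstar ((h + h') v)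
      = (h - form_wedge vstar (h v)) + (h' - form_wedge vstar (h' v))"
    by (simp add: form_wedge_def fun_eq_iff algebra_simps)
  with add show ?case by (simp only: cvs.subspace_add[OF subspace_ext2_forms])
next
  case (scale c h)
  have "c *\<^sub>C h - form_wedge vstar ((c *\<^sub>C h) v) = c *\<^sub>C (h - form_wedge vstar (h v))"
    by (simp add: form_wedge_def fun_eq_iff algebra_simps)
  with scale show ?case by (simp only: cvs.subspace_scale[OF subspace_ext2_forms])
qed

section \<open>Subspaces transversal to the forms on the hyperplane\<close>

text \<open>For a frame \<open>w\<close> of a space \<open>H\<close> of alternating forms, the determinant of the projection
  \<open>h \<mapsto> h(v, \<cdot>)\<close> from \<open>H\<close> to the dual of \<open>W\<close>.\<close>

definition frame_det :: "(nat \<Rightarrow> 'v \<Rightarrow> 'v \<Rightarrow> complex) \<Rightarrow> complex"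
  where "frame_det w = det (mat k k (\<lambda>(i, j). w j v (e i)))"

lemma frame_det_pluecker: "(1, frame_det) \<in> hom_pluecker k"
proof -
  have "(1, \<lambda>w. det (mat k k (\<lambda>(i, j). (\<lambda>h. h v (e i)) (w j)))) \<in> hom_pluecker k"
    by (rule hom_pluecker.coord) (simp add: dual_iff)
  then show ?thesis by (simp add: frame_det_def[abs_def])
qed

text \<open>The spaces \<open>H\<close> that project isomorphically to the dual of \<open>W\<close>. If one frame of \<open>H\<close> has
  nonzero determinant, then all frames do.\<close>

definition transversal :: "('v \<Rightarrow> 'v \<Rightarrow> complex) set set"
  where "transversal = {H \<in> gr k (ext2_forms dual).
    \<exists>w. cvs.span (w ` {..<k}) = H \<and> frame_det w \<noteq> 0}"

lemma zariski_open_transversal: "zariski_open k (ext2_forms dual) transversal"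
proof -
  have "gr k (ext2_forms dual) - transversal =
    {L \<in> gr k (ext2_forms dual). \<forall>(d, p) \<in> {(1, frame_det)}.
       \<forall>w. cvs.span (w ` {..<k}) = L \<longrightarrow> p w = 0}"
    by (auto simp: transversal_def)
  then show ?thesis
    unfolding zariski_open_def zariski_closed_def
    using frame_det_pluecker by (intro conjI exI[of _ "{(1, frame_det)}"]) (auto simp: transversal_def)
qed

lemma transversal_nonempty: "transversal \<noteq> {}"
proof -
  \<comment> \<open>The space \<open>v* \<and> W*\<close> with its frame \<open>v* \<and> e\<^sub>j*\<close> has determinant \<open>1\<close>.\<close>
  define w where "w j = form_wedge vstar (coord j)" for j
  have wv: "w j v = coord j" for j
    by (simp add: w_def form_wedge_vstar_at_v coord_dual_vanishing)
  have "mat k k (\<lambda>(i, j). w j v (e i)) = 1\<^sub>m k"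
    by (rule eq_matI) (auto simp: wv coord_e)
  then have det: "frame_det w = 1" by (simp add: frame_det_def)
  have inj: "inj_on w {..<k}"
  proof (rule inj_onI)
    fix i j assume *: "i \<in> {..<k}" "j \<in> {..<k}" "w i = w j"
    then have "coord i (e i) = coord j (e i)" using wv by metis
    with * show "i = j" by (auto simp: coord_e split: if_splits)
  qed
  have indep: "cvs.independent (w ` {..<k})"
  proof (rule cvs.independent_if_scalars_zero)
    fix f x assume *: "(\<Sum>x\<in>w ` {..<k}. f x *\<^sub>C x) = 0" "x \<in> w ` {..<k}"
    then obtain i where i: "i < k" "x = w i" by auto
    have "0 = (\<Sum>j<k. f (w j) *\<^sub>C w j) v (e i)"
      using * by (simp only: sum.reindex[OF inj] o_def zero_fun_apply)
    also have "\<dots> = (\<Sum>j<k. f (w j) * coord j (e i))"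
      by (simp add: sum_fun_apply wv)
    also have "\<dots> = (\<Sum>j<k. if j = i then f (w j) else 0)"
      using i by (intro sum.cong) (auto simp: coord_e)
    also have "\<dots> = f x" using i by simp
    finally show "f x = 0" by simp
  qed simp
  have "cvs.span (w ` {..<k}) \<subseteq> ext2_forms dual"
    using coord_dual_vanishing vstar_dual dual_vanishing_subset
    by (intro cvs.span_minimal[OF _ subspace_ext2_forms])
      (auto simp: w_def intro!: form_wedge_in_ext2_forms)
  then have "cvs.span (w ` {..<k}) \<in> transversal"
    using det cvs.dim_eq_card_independent[OF indep] card_image[OF inj]
    by (auto simp: transversal_def gr_def)
  then show ?thesis by blast
qed

text \<open>In the basis \<open>e\<close>, the equation \<open>h(v, \<cdot>) = u\<close> for \<open>h = \<Sum>\<^sub>j c\<^sub>j w\<^sub>j\<close> is a square linear system in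
  \<open>c\<close> whose matrix has determinant \<open>frame_det w\<close>.\<close>

lemma transversal_ex1:
  assumes "H \<in> transversal" "u \<in> dual_vanishing v"
  shows "\<exists>!h. h \<in> H \<and> h v = u"
proof -
  obtain w where w: "cvs.span (w ` {..<k}) = H" "frame_det w \<noteq> 0" and H: "H \<subseteq> ext2_forms dual"
    using assms(1) by (auto simp: transversal_def gr_def)
  define A where "A = mat k k (\<lambda>(i, j). w j v (e i))"
  have A: "A \<in> carrier_mat k k" by (simp add: A_def)
  have "A \<in> Units (ring_mat TYPE(complex) k ())"
    using det_non_zero_imp_unit[OF A] w(2) by (simp add: frame_det_def A_def)
  then obtain B where B: "B \<in> carrier_mat k k" "B * A = 1\<^sub>m k" "A * B = 1\<^sub>m k"
    by (auto simp: Units_def ring_mat_def)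
  define b where "b = vec k (\<lambda>i. u (e i))"
  have b: "b \<in> carrier_vec k" by (simp add: b_def)
  have at_v: "(\<Sum>j<k. c j *\<^sub>C w j) v = u \<longleftrightarrow> A *\<^sub>v vec k c = b" for c
  proof -
    have entry: "(A *\<^sub>v vec k c) $ i = (\<Sum>j<k. c j *\<^sub>C w j) v (e i)" if "i < k" for i
      using that
      by (simp add: A_def scalar_prod_def sum_fun_apply mult.commute lessThan_atLeast0)
    have "(\<Sum>j<k. c j *\<^sub>C w j) \<in> H"
      unfolding w(1)[symmetric]
      by (intro cvs.span_sum cvs.span_scale cvs.span_base) auto
    then have dv: "(\<Sum>j<k. c j *\<^sub>C w j) v \<in> dual_vanishing v"
      using H form_at_v_dual_vanishing by blast
    have "A *\<^sub>v vec k c = b \<longleftrightarrow> (\<forall>i<k. (\<Sum>j<k. c j *\<^sub>C w j) v (e i) = u (e i))"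
      using A entry by (auto simp only: vec_eq_iff) (auto simp: b_def)
    then show ?thesis
      using dual_vanishing_eqI[OF dv assms(2)] by metis
  qed
  have solve: "A *\<^sub>v x = b \<longleftrightarrow> x = B *\<^sub>v b" if "x \<in> carrier_vec k" for x
    using that A B b by (metis assoc_mult_mat_vec one_mult_mat_vec)
  show ?thesis
  proof (rule ex_ex1I)
    define c where "c j = (B *\<^sub>v b) $ j" for j
    have c: "vec k c = B *\<^sub>v b" using B b by (auto simp: c_def)
    then have "(\<Sum>j<k. c j *\<^sub>C w j) v = u" using at_v[of c] solve[of "vec k c"] by (metis vec_carrier)
    moreover have "(\<Sum>j<k. c j *\<^sub>C w j) \<in> H"
      unfolding w(1)[symmetric]
      by (intro cvs.span_sum cvs.span_scale cvs.span_base) auto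
    ultimately show "\<exists>h. h \<in> H \<and> h v = u" by blast
  next
    fix h h' assume *: "h \<in> H \<and> h v = u" "h' \<in> H \<and> h' v = u"
    have "h \<in> cvs.span (w ` {..<k})" "h' \<in> cvs.span (w ` {..<k})" using * w(1) by simp_all
    from this[THEN span_image_sum] obtain c c'
      where c: "h = (\<Sum>j<k. c j *\<^sub>C w j)" "h' = (\<Sum>j<k. c' j *\<^sub>C w j)"
      by blast
    have "A *\<^sub>v vec k c = b" "A *\<^sub>v vec k c' = b"
      using * unfolding c at_v by blast+
    then have "vec k c = vec k c'"
      using solve[of "vec k c"] solve[of "vec k c'"] by simp
    then have "c j = c' j" if "j < k" for j using that by (metis index_vec)
    then show "h = h'" unfolding c by (intro sum.cong) auto
  qed
qed

lemma assoc_morphism_in_H_at_v: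
  assumes "assoc_morphism v vstar H \<omega>" "u \<in> dual_vanishing v"
  shows "\<omega> u + form_wedge vstar u \<in> H" "(\<omega> u + form_wedge vstar u) v = u"
proof -
  show "\<omega> u + form_wedge vstar u \<in> H" using assms by (auto simp: assoc_morphism_def)
  have "\<omega> u \<in> ext2_forms (dual_vanishing v)"
    using assms by (auto simp: assoc_morphism_def linear_on_def)
  then show "(\<omega> u + form_wedge vstar u) v = u"
    using form_wedge_vstar_at_v[OF assms(2)] form_vanishing_at_v[of "\<omega> u"]
    by (simp only: plus_fun_apply add_0)
qed

lemma transversal_assoc_morphism_ex1:
  assumes "H \<in> transversal"
  shows "\<exists>!\<omega>. assoc_morphism v vstar H \<omega>"
proof -
  let ?D = "dual_vanishing v"
  have subH: "cvs.subspace H" and H: "H \<subseteq> ext2_forms dual"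
    using assms by (auto simp: transversal_def gr_def)
  note ex1 = transversal_ex1[OF assms]
  define g where "g u = (THE h. h \<in> H \<and> h v = u)" for u
  have g: "g u \<in> H" "g u v = u" if "u \<in> ?D" for u
    using theI'[OF ex1[OF that]] by (auto simp: g_def)
  have g_eq: "g u = h" if "u \<in> ?D" "h \<in> H" "h v = u" for u h
    using ex1[OF that(1)] g[OF that(1)] that by blast
  define \<omega> where "\<omega> = restrict (\<lambda>u. g u - form_wedge vstar u) ?D"
  have "assoc_morphism v vstar H \<omega>"
    unfolding assoc_morphism_def linear_on_def
  proof (intro conjI ballI allI)
    show "\<omega> \<in> extensional ?D" by (simp add: \<omega>_def)
    show "\<omega> u \<in> ext2_forms ?D" if "u \<in> ?D" for u
      using ext2_forms_decomp[of "g u"] g[OF that] H that by (auto simp: \<omega>_def)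
    show "\<omega> (u + u') = \<omega> u + \<omega> u'" if "u \<in> ?D" "u' \<in> ?D" for u u'
    proof -
      have D: "u + u' \<in> ?D" using that cvs.subspace_add[OF subspace_dual_vanishing] by blast
      have "g (u + u') = g u + g u'"
        using that g by (intro g_eq D cvs.subspace_add[OF subH]) auto
      then show ?thesis using that D by (simp only: \<omega>_def restrict_apply' form_wedge_right_linear add_diff_add)
    qed
    show "\<omega> (c *\<^sub>C u) = c *\<^sub>C \<omega> u" if "u \<in> ?D" for c u
    proof -
      have D: "c *\<^sub>C u \<in> ?D" using that cvs.subspace_scale[OF subspace_dual_vanishing] by blast
      have "g (c *\<^sub>C u) = c *\<^sub>C g u"
        using that g by (intro g_eq D cvs.subspace_scale[OF subH]) (auto simp: fun_eq_iff)
      then show ?thesis using that D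
        by (simp only: \<omega>_def restrict_apply' form_wedge_right_linear cvs.scale_right_diff_distrib)
    qed
    have "h = \<omega> (h v) + form_wedge vstar (h v) \<and> h v \<in> ?D" if "h \<in> H" for h
      using that H form_at_v_dual_vanishing[of h] g_eq[of "h v" h] by (auto simp: \<omega>_def)
    moreover have "\<omega> u + form_wedge vstar u \<in> H" if "u \<in> ?D" for u
      using g that by (simp add: \<omega>_def)
    ultimately show "H = {\<omega> u + form_wedge vstar u |u. u \<in> ?D}" by blast
  qed
  moreover have "\<omega>' = \<omega>" if "assoc_morphism v vstar H \<omega>'" for \<omega>'
  proof (rule extensionalityI)
    show "\<omega>' \<in> extensional ?D" using that by (simp add: assoc_morphism_def)
    show "\<omega> \<in> extensional ?D" by (simp add: \<omega>_def)
    show "\<omega>' u = \<omega> u" if u: "u \<in> ?D" for u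
      unfolding \<omega>_def restrict_apply'[OF u]
        g_eq[OF u assoc_morphism_in_H_at_v[OF \<open>assoc_morphism v vstar H \<omega>'\<close> u]]
      by (rule add_diff_cancel_right'[symmetric])
  qed
  ultimately show ?thesis by blast
qed

section \<open>Projecting bivectors to the hyperplane\<close>

text \<open>The pullback of a form along the projection to \<open>W\<close>, and the dual map on bivectors.\<close>

definition pull :: "('v \<Rightarrow> 'v \<Rightarrow> complex) \<Rightarrow> 'v \<Rightarrow> 'v \<Rightarrow> complex"
  where "pull h = (\<lambda>a b. h (proj a) (proj b))"

definition push :: "(('v \<Rightarrow> 'v \<Rightarrow> complex) \<Rightarrow> complex) \<Rightarrow> ('v \<Rightarrow> 'v \<Rightarrow> complex) \<Rightarrow> complex"
  where "push \<theta> = (\<lambda>h. if h \<in> ext2_forms dual then \<theta> (pull h) else 0)"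

lemma pull_ext2_forms: "h \<in> ext2_forms dual \<Longrightarrow> pull h \<in> ext2_forms dual"
proof (induction rule: ext2_forms_induct)
  case (wedge f g)
  have "pull (form_wedge f g) = form_wedge (f \<circ> proj) (g \<circ> proj)"
    by (simp add: pull_def form_wedge_def)
  moreover have "f \<circ> proj \<in> dual" "g \<circ> proj \<in> dual"
    using wedge by (auto simp: dual_iff proj_linear)
  ultimately show ?case by (simp add: form_wedge_in_ext2_forms)
next
  case zero
  have "pull 0 = 0" by (simp add: pull_def fun_eq_iff)
  then show ?case by (simp only: cvs.subspace_0[OF subspace_ext2_forms])
next
  case (add h h')
  have "pull (h + h') = pull h + pull h'" by (simp add: pull_def fun_eq_iff)
  with add show ?case by (simp only: cvs.subspace_add[OF subspace_ext2_forms])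
next
  case (scale c h)
  have "pull (c *\<^sub>C h) = c *\<^sub>C pull h" by (simp add: pull_def fun_eq_iff)
  with scale show ?case by (simp only: cvs.subspace_scale[OF subspace_ext2_forms])
qed

lemma push_linear: "push (\<theta> + \<theta>') = push \<theta> + push \<theta>'" "push (c *\<^sub>C \<theta>) = c *\<^sub>C push \<theta>"
  "push 0 = 0"
  by (auto simp: push_def fun_eq_iff)

lemma push_wedge: "push (vec_wedge a b) = vec_wedge (proj a) (proj b)"
  using pull_ext2_forms by (auto simp: push_def vec_wedge_def pull_def fun_eq_iff)

lemma push_in_ext2: "\<theta> \<in> ext2 UNIV \<Longrightarrow> push \<theta> \<in> ext2 W"
  by (induction rule: ext2_induct)
    (simp_all only: push_linear push_wedge vec_wedge_in_ext2 proj_in_W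
      cvs.subspace_0[OF subspace_ext2] cvs.subspace_add[OF subspace_ext2]
      cvs.subspace_scale[OF subspace_ext2])

lemma push_ext2_W: "\<eta> \<in> ext2 W \<Longrightarrow> push \<eta> = \<eta>"
  by (induction rule: ext2_induct) (simp_all only: push_linear push_wedge proj_W)

lemma wedge_decomp:
  "vec_wedge a b = vec_wedge (proj a) (proj b)
     + vec_wedge v (vstar a *\<^sub>C proj b - vstar b *\<^sub>C proj a)"
proof -
  have "vec_wedge a b h = (vec_wedge (proj a) (proj b)
     + vec_wedge v (vstar a *\<^sub>C proj b - vstar b *\<^sub>C proj a)) h" for h
  proof (cases "h \<in> ext2_forms dual")
    case True
    have "h a b = h (proj a + vstar a *\<^sub>C v) (proj b + vstar b *\<^sub>C v)"
      by (simp add: proj_def)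
    also have "\<dots> = h (proj a) (proj b) + vstar a * h v (proj b) + vstar b * h (proj a) v"
      by (simp only: ext2_forms_bilinear[OF True]) (simp add: algebra_simps)
    also have "h (proj a) v = - h v (proj a)" by (rule ext2_forms_dualD[OF True])
    finally show ?thesis
      using True
      by (simp add: vec_wedge_def dual_simps[OF ext2_forms_dualD(1)[OF True]])
  qed (simp add: vec_wedge_def)
  then show ?thesis by (rule ext)
qed

lemma ext2_decomp:
  assumes "\<theta> \<in> ext2 UNIV"
  shows "\<exists>x\<in>W. \<theta> = push \<theta> + vec_wedge v x"
  using assms
proof (induction rule: ext2_induct)
  case (wedge a b)
  have "vstar a *\<^sub>C proj b - vstar b *\<^sub>C proj a \<in> W"
    by (intro cvs.subspace_diff[OF subspace_W] cvs.subspace_scale[OF subspace_W] proj_in_W)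
  then show ?case using wedge_decomp push_wedge by metis
next
  case zero
  have "0 = push 0 + vec_wedge v 0" by (simp only: push_linear vec_wedge_bilinear(8) add_0)
  then show ?case using cvs.subspace_0[OF subspace_W] by blast
next
  case (add \<theta> \<theta>')
  then obtain x x' where *: "x \<in> W" "x' \<in> W" "\<theta> = push \<theta> + vec_wedge v x"
    "\<theta>' = push \<theta>' + vec_wedge v x'" by blast
  have "\<theta> + \<theta>' = (push \<theta> + vec_wedge v x) + (push \<theta>' + vec_wedge v x')"
    using *(3,4) by (rule arg_cong2)
  also have "\<dots> = push (\<theta> + \<theta>') + vec_wedge v (x + x')"
    by (simp only: push_linear(1) vec_wedge_bilinear(1) ac_simps)
  finally show ?case using *(1,2) cvs.subspace_add[OF subspace_W] by blast
next
  case (scale c \<theta>)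
  then obtain x where *: "x \<in> W" "\<theta> = push \<theta> + vec_wedge v x" by blast
  have "c *\<^sub>C \<theta> = c *\<^sub>C (push \<theta> + vec_wedge v x)"
    using *(2) by (rule arg_cong)
  also have "\<dots> = push (c *\<^sub>C \<theta>) + vec_wedge v (c *\<^sub>C x)"
    by (simp only: push_linear(2) vec_wedge_bilinear(2) scaleC_add_right)
  finally show ?case using *(1) cvs.subspace_scale[OF subspace_W] by blast
qed

lemma ext2_W_form_wedge_vstar: "\<eta> \<in> ext2 W \<Longrightarrow> \<eta> (form_wedge vstar g) = 0"
  by (induction rule: ext2_induct) (auto simp: vec_wedge_def form_wedge_def W_eq)

section \<open>The projective equivalence\<close>

text \<open>The transpose of \<open>\<omega>\<close>, by its coordinates in the basis \<open>e\<close>. On the exterior square of \<open>W\<close> it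
  agrees with \<open>transpose_morphism\<close>, but it is visibly linear in \<open>\<eta>\<close>.\<close>

definition adjoint :: "(('v \<Rightarrow> complex) \<Rightarrow> 'v \<Rightarrow> 'v \<Rightarrow> complex) \<Rightarrow>
    (('v \<Rightarrow> 'v \<Rightarrow> complex) \<Rightarrow> complex) \<Rightarrow> 'v"
  where "adjoint \<omega> \<eta> = (\<Sum>i<k. \<eta> (\<omega> (coord i)) *\<^sub>C e i)"

lemma adjoint_in_W: "adjoint \<omega> \<eta> \<in> W"
  unfolding adjoint_def
  by (intro cvs.subspace_sum[OF subspace_W] cvs.subspace_scale[OF subspace_W] e_in_W) simp

lemma adjoint_scale: "adjoint \<omega> (c *\<^sub>C \<eta>) = c *\<^sub>C adjoint \<omega> \<eta>"
  by (simp add: adjoint_def cvs.scale_sum_right scaleC_scaleC)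

context
  fixes H \<omega>
  assumes assoc: "assoc_morphism v vstar H \<omega>"
begin

lemma omega_vanishing: "u \<in> dual_vanishing v \<Longrightarrow> \<omega> u \<in> ext2_forms (dual_vanishing v)"
  using assoc by (simp add: assoc_morphism_def linear_on_def)

lemma omega_form: "u \<in> dual_vanishing v \<Longrightarrow> \<omega> u \<in> ext2_forms dual"
  using omega_vanishing ext2_forms_mono[OF dual_vanishing_subset] by (rule subsetD[rotated])

lemma omega_sum: "\<omega> (\<Sum>i<m. c i *\<^sub>C coord i) = (\<Sum>i<m. c i *\<^sub>C \<omega> (coord i))"
proof -
  have add: "\<omega> (u + u') = \<omega> u + \<omega> u'" if "u \<in> dual_vanishing v" "u' \<in> dual_vanishing v" for u u'
    using assoc that by (simp only: assoc_morphism_def linear_on_def)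
  have scale: "\<omega> (c *\<^sub>C u) = c *\<^sub>C \<omega> u" if "u \<in> dual_vanishing v" for c u
    using assoc that by (simp only: assoc_morphism_def linear_on_def)
  have D: "c i *\<^sub>C coord i \<in> dual_vanishing v" for i
    by (rule cvs.subspace_scale[OF subspace_dual_vanishing coord_dual_vanishing])
  show ?thesis
  proof (induction m)
    case 0
    show ?case using scale[OF coord_dual_vanishing, of 0 0]
      by (simp only: cvs.scale_zero_left lessThan_0 sum.empty)
  next
    case (Suc m)
    have "(\<Sum>i<m. c i *\<^sub>C coord i) \<in> dual_vanishing v"
      by (rule cvs.subspace_sum[OF subspace_dual_vanishing D])
    then show ?case
      unfolding sum.lessThan_Suc using Suc
      by (simp only: add[OF _ D] scale[OF coord_dual_vanishing])
  qed
qed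

lemma adjoint_pairing:
  assumes "\<eta> \<in> ext2 W" "u \<in> dual_vanishing v"
  shows "u (adjoint \<omega> \<eta>) = \<eta> (\<omega> u)"
proof -
  have "\<omega> u = (\<Sum>i<k. u (e i) *\<^sub>C \<omega> (coord i))"
    using arg_cong[OF dual_vanishing_expand[OF assms(2)], of \<omega>] omega_sum by (rule trans)
  then have "\<eta> (\<omega> u) = \<eta> (\<Sum>i<k. u (e i) *\<^sub>C \<omega> (coord i))" by (rule arg_cong)
  also have "\<dots> = (\<Sum>i<k. u (e i) * \<eta> (\<omega> (coord i)))"
    by (rule ext2_sum[OF assms(1) omega_form[OF coord_dual_vanishing]])
  also have "\<dots> = u (adjoint \<omega> \<eta>)"
    using subsetD[OF dual_vanishing_subset assms(2)]
    by (simp add: adjoint_def dual_simps mult.commute)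
  finally show ?thesis by (rule sym)
qed

lemma adjoint_eqI:
  assumes "\<eta> \<in> ext2 W" "x \<in> W" "\<And>u. u \<in> dual_vanishing v \<Longrightarrow> u x = \<eta> (\<omega> u)"
  shows "x = adjoint \<omega> \<eta>"
  using assms(3) adjoint_pairing[OF assms(1)] by (intro W_eqI assms(2) adjoint_in_W) simp

lemma transpose_morphism_eq:
  assumes "\<eta> \<in> ext2 W"
  shows "transpose_morphism W v \<omega> \<eta> = adjoint \<omega> \<eta>"
  unfolding transpose_morphism_def
  using assms adjoint_in_W adjoint_pairing adjoint_eqI by (intro the_equality) auto

lemma perp_iff: "\<theta> \<in> perp H \<longleftrightarrow>
  \<theta> \<in> ext2 UNIV \<and> (\<forall>u\<in>dual_vanishing v. \<theta> (\<omega> u + form_wedge vstar u) = 0)"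
proof -
  have H: "H = {\<omega> u + form_wedge vstar u |u. u \<in> dual_vanishing v}"
    using assoc by (simp only: assoc_morphism_def)
  show ?thesis unfolding perp_def H by blast
qed

text \<open>In the value of \<open>\<omega>(u) + v* \<and> u\<close> on \<open>\<eta> + v \<and> x\<close>, the mixed terms vanish: \<open>v* \<and> u\<close> is zero on
  bivectors of \<open>W\<close>, and \<open>\<omega>(u)\<close> is zero on \<open>v \<and> x\<close>.\<close>

lemma eval_on_H:
  assumes "\<eta> \<in> ext2 W" "u \<in> dual_vanishing v" "x \<in> W"
  shows "(\<eta> + vec_wedge v x) (\<omega> u + form_wedge vstar u) = \<eta> (\<omega> u) + u x"
proof -
  have forms: "\<omega> u \<in> ext2_forms dual" "form_wedge vstar u \<in> ext2_forms dual"
    using omega_form[OF assms(2)] subsetD[OF dual_vanishing_subset assms(2)] vstar_dual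
    by (auto intro: form_wedge_in_ext2_forms)
  then have sum: "\<omega> u + form_wedge vstar u \<in> ext2_forms dual"
    by (rule cvs.subspace_add[OF subspace_ext2_forms])
  have "\<eta> (\<omega> u + form_wedge vstar u) = \<eta> (\<omega> u)"
    using ext2_linear(1)[OF assms(1) forms] ext2_W_form_wedge_vstar[OF assms(1), of u] by simp
  moreover have "vec_wedge v x (\<omega> u + form_wedge vstar u) = u x"
    using sum assoc_morphism_in_H_at_v(2)[OF assoc assms(2)] by (simp only: vec_wedge_def if_True)
  ultimately show ?thesis by (simp only: plus_fun_apply)
qed

lemma perp_decomp:
  assumes "\<theta> \<in> perp H"
  shows "\<theta> = push \<theta> - vec_wedge v (adjoint \<omega> (push \<theta>))"
proof -
  have \<theta>: "\<theta> \<in> ext2 UNIV" using assms perp_iff by blast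
  obtain x where x: "x \<in> W" "\<theta> = push \<theta> + vec_wedge v x"
    using ext2_decomp[OF \<theta>] by blast
  note \<eta> = push_in_ext2[OF \<theta>]
  have "- x = adjoint \<omega> (push \<theta>)"
  proof (rule adjoint_eqI[OF \<eta>])
    show "- x \<in> W" using x(1) by (rule cvs.subspace_neg[OF subspace_W])
    fix u assume u: "u \<in> dual_vanishing v"
    have "0 = \<theta> (\<omega> u + form_wedge vstar u)" using assms u perp_iff by simp
    also have "\<dots> = push \<theta> (\<omega> u) + u x"
      using eval_on_H[OF \<eta> u x(1)] unfolding x(2)[symmetric] .
    finally show "u (- x) = push \<theta> (\<omega> u)"
      using subsetD[OF dual_vanishing_subset u]
      by (simp add: dual_simps eq_neg_iff_add_eq_0 neg_eq_iff_add_eq_0 add.commute)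
  qed
  then have "vec_wedge v x = - vec_wedge v (adjoint \<omega> (push \<theta>))"
    by (metis vec_wedge_minus_right minus_minus)
  then show ?thesis using x(2) by (simp only: diff_conv_add_uminus)
qed

lemma lift_in_perp:
  assumes "\<eta> \<in> ext2 W"
  shows "\<eta> - vec_wedge v (adjoint \<omega> \<eta>) \<in> perp H"
proof -
  have lift: "\<eta> - vec_wedge v (adjoint \<omega> \<eta>) = \<eta> + vec_wedge v (- adjoint \<omega> \<eta>)"
    by (simp only: vec_wedge_minus_right diff_conv_add_uminus)
  show ?thesis
    unfolding perp_iff
  proof (intro conjI ballI)
    show "\<eta> - vec_wedge v (adjoint \<omega> \<eta>) \<in> ext2 UNIV"
      using assms subsetD[OF ext2_mono[of W UNIV]]
      by (intro cvs.subspace_diff[OF subspace_ext2] vec_wedge_in_ext2) auto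
    fix u assume u: "u \<in> dual_vanishing v"
    have "(\<eta> - vec_wedge v (adjoint \<omega> \<eta>)) (\<omega> u + form_wedge vstar u)
        = \<eta> (\<omega> u) + u (- adjoint \<omega> \<eta>)"
      unfolding lift
      by (rule eval_on_H[OF assms u cvs.subspace_neg[OF subspace_W adjoint_in_W]])
    also have "\<dots> = 0"
      using subsetD[OF dual_vanishing_subset u] adjoint_pairing[OF assms u]
      by (simp add: dual_simps(4))
    finally show "(\<eta> - vec_wedge v (adjoint \<omega> \<eta>)) (\<omega> u + form_wedge vstar u) = 0" .
  qed
qed

lemma push_lift:
  assumes "\<eta> \<in> ext2 W"
  shows "push (\<eta> - vec_wedge v x) = \<eta>"
proof -
  have "push (\<eta> - vec_wedge v x) = push \<eta> + (- 1) *\<^sub>C push (vec_wedge v x)"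
    by (simp only: push_linear(1) push_linear(2)[symmetric] cvs.scale_minus_left cvs.scale_one
        diff_conv_add_uminus)
  then show ?thesis
    by (simp only: push_wedge proj_v vec_wedge_bilinear(7) push_ext2_W[OF assms] cvs.scale_zero_right
        add_0_right)
qed

lemma bij_push: "bij_betw push (perp H) (ext2 W)"
proof (rule bij_betw_byWitness[where f' = "\<lambda>\<eta>. \<eta> - vec_wedge v (adjoint \<omega> \<eta>)"])
  show "\<forall>\<theta>\<in>perp H. push \<theta> - vec_wedge v (adjoint \<omega> (push \<theta>)) = \<theta>"
    using perp_decomp[symmetric] by blast
  show "\<forall>\<eta>\<in>ext2 W. push (\<eta> - vec_wedge v (adjoint \<omega> \<eta>)) = \<eta>"
    using push_lift by blast
  show "push ` perp H \<subseteq> ext2 W"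
    using push_in_ext2 perp_iff by blast
  show "(\<lambda>\<eta>. \<eta> - vec_wedge v (adjoint \<omega> \<eta>)) ` ext2 W \<subseteq> perp H"
    using lift_in_perp by blast
qed

lemma push_span: "push ` cvs.span {\<theta>} = cvs.span {push \<theta>}"
  by (auto simp only: cvs.span_singleton push_linear image_image)

lemma wedge_in_perp_iff:
  "vec_wedge a b \<in> perp H \<longleftrightarrow>
   adjoint \<omega> (vec_wedge (proj a) (proj b)) = vstar b *\<^sub>C proj a - vstar a *\<^sub>C proj b"
  (is "_ \<longleftrightarrow> adjoint \<omega> ?\<eta> = ?x")
proof -
  have \<eta>: "?\<eta> \<in> ext2 W" by (intro vec_wedge_in_ext2 proj_in_W)
  have x: "?x \<in> W"
    by (intro cvs.subspace_diff[OF subspace_W] cvs.subspace_scale[OF subspace_W] proj_in_W)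
  have "vec_wedge a b = ?\<eta> + vec_wedge v ((- 1) *\<^sub>C ?x)"
    using wedge_decomp[of a b]
    by (simp only: cvs.scale_minus_left cvs.scale_one minus_diff_eq)
  then have "vec_wedge a b (\<omega> u + form_wedge vstar u) = ?\<eta> (\<omega> u) - u ?x"
    if "u \<in> dual_vanishing v" for u
    using eval_on_H[OF \<eta> that cvs.subspace_scale[OF subspace_W x], of "- 1"]
      dual_simps(2)[OF subsetD[OF dual_vanishing_subset that], of "- 1" ?x]
    by (simp only:) simp
  then have "vec_wedge a b \<in> perp H \<longleftrightarrow> (\<forall>u\<in>dual_vanishing v. u ?x = ?\<eta> (\<omega> u))"
    using vec_wedge_in_ext2[of a UNIV b] unfolding perp_iff by fastforce
  also have "\<dots> \<longleftrightarrow> adjoint \<omega> ?\<eta> = ?x"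
    using adjoint_eqI[OF \<eta> x] adjoint_pairing[OF \<eta>] by metis
  finally show ?thesis .
qed

lemma push_linear_section:
  assumes "l \<in> linear_section H"
  shows "push ` l \<in> pluecker (Y_planes W (transpose_morphism W v \<omega>))"
proof -
  obtain a b where l: "l = cvs.span {vec_wedge a b}" and sub: "l \<subseteq> perp H" and dim: "cvs.dim l = 1"
    using assms by (auto simp: linear_section_def pluecker_def gr_def)
  have perp: "vec_wedge a b \<in> perp H" using l sub cvs.span_base by blast
  let ?\<eta> = "vec_wedge (proj a) (proj b)"
  have \<eta>: "?\<eta> \<in> ext2 W" by (intro vec_wedge_in_ext2 proj_in_W)
  have "vec_wedge a b \<noteq> 0" using dim l cvs.dim_le_card[of "{0 :: ('v \<Rightarrow> 'v \<Rightarrow> complex) \<Rightarrow> complex}" "{}"]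
    by (auto simp: cvs.dim_span)
  moreover have "0 \<in> perp H" using perp_iff cvs.subspace_0[OF subspace_ext2] by auto
  ultimately have "?\<eta> \<noteq> 0"
    using inj_onD[OF bij_betw_imp_inj_on[OF bij_push] _ perp, of 0] push_wedge push_linear(3) by metis
  then have "cvs.dim {proj a, proj b} = 2" by (simp only: dim_pair_eq_2_iff not_False_eq_True)
  moreover have "cvs.span {proj a, proj b} \<subseteq> W"
    using proj_in_W by (intro cvs.span_minimal[OF _ subspace_W]) auto
  moreover have "transpose_morphism W v \<omega> ?\<eta> \<in> cvs.span {proj a, proj b}"
    unfolding transpose_morphism_eq[OF \<eta>] wedge_in_perp_iff[THEN iffD1, OF perp]
    by (intro cvs.span_diff cvs.span_scale cvs.span_base) auto
  ultimately have "cvs.span {proj a, proj b} \<in> Y_planes W (transpose_morphism W v \<omega>)"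
    unfolding Y_planes_def gr_def by (auto simp: cvs.dim_span)
  then show ?thesis
    unfolding l push_span push_wedge pluecker_def by blast
qed

text \<open>The plane \<open>\<langle>a, b\<rangle>\<close> of \<open>Y\<close> with \<open>\<omega>(a, b) = t a - s b\<close> is the projection of the plane
  \<open>\<langle>a + s v, b + t v\<rangle>\<close>, whose bivector annihilates \<open>H\<close>.\<close>

lemma lift_Y_planes:
  assumes "m \<in> pluecker (Y_planes W (transpose_morphism W v \<omega>))"
  shows "\<exists>l \<in> linear_section H. push ` l = m"
proof -
  obtain a b where m: "m = cvs.span {vec_wedge a b}"
    and Y: "cvs.span {a, b} \<in> Y_planes W (transpose_morphism W v \<omega>)"
    using assms by (auto simp: pluecker_def)
  then obtain a' b' where ab': "cvs.span {a, b} = cvs.span {a', b'}"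
    "transpose_morphism W v \<omega> (vec_wedge a' b') \<in> cvs.span {a, b}"
    by (auto simp: Y_planes_def)
  have sub: "cvs.span {a, b} \<subseteq> W" and dim: "cvs.dim {a, b} = 2"
    using Y by (auto simp: Y_planes_def gr_def cvs.dim_span)
  have W: "a \<in> W" "b \<in> W" "a' \<in> W" "b' \<in> W"
    using sub ab'(1) cvs.span_base[of _ "{a, b}"] cvs.span_base[of _ "{a', b'}"] by auto
  let ?\<eta> = "vec_wedge a b"
  have \<eta>: "?\<eta> \<in> ext2 W" "vec_wedge a' b' \<in> ext2 W" using W by (auto intro: vec_wedge_in_ext2)
  \<comment> \<open>Membership in \<open>Y\<close> is witnessed by some basis of the plane; changing the basis rescales
    the bivector, so the condition holds for \<open>a, b\<close> as well.\<close>
  have "?\<eta> \<in> cvs.span {vec_wedge a' b'}"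
    unfolding ab'(1)[symmetric]
    by (rule wedge_in_span_wedge; unfold ab'(1)[symmetric]; rule cvs.span_base; simp)
  then obtain c where "?\<eta> = c *\<^sub>C vec_wedge a' b'"
    by (auto simp only: cvs.span_singleton)
  then have "adjoint \<omega> ?\<eta> = c *\<^sub>C transpose_morphism W v \<omega> (vec_wedge a' b')"
    by (simp only: adjoint_scale transpose_morphism_eq[OF \<eta>(2)])
  then have "adjoint \<omega> ?\<eta> \<in> cvs.span {a, b}" using ab'(2) cvs.span_scale by simp
  then obtain s t where st: "adjoint \<omega> ?\<eta> = t *\<^sub>C a - s *\<^sub>C b"
  proof -
    assume *: "\<And>t s. adjoint \<omega> ?\<eta> = t *\<^sub>C a - s *\<^sub>C b \<Longrightarrow> thesis"
    assume "adjoint \<omega> ?\<eta> \<in> cvs.span {a, b}"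
    then obtain t s where "adjoint \<omega> ?\<eta> - t *\<^sub>C a = s *\<^sub>C b"
      by (auto simp only: cvs.span_breakdown_eq cvs.span_singleton)
    then have "adjoint \<omega> ?\<eta> = t *\<^sub>C a - (- s) *\<^sub>C b"
      by (simp add: algebra_simps)
    then show thesis by (rule *)
  qed
  define a1 b1 where "a1 = a + s *\<^sub>C v" and "b1 = b + t *\<^sub>C v"
  have proj: "proj a1 = a" "proj b1 = b"
    by (simp_all add: a1_def b1_def proj_linear proj_v proj_W W)
  have vs: "vstar a1 = s" "vstar b1 = t"
    using W by (simp_all add: a1_def b1_def dual_simps[OF vstar_dual] vstar_v W_eq)
  have perp: "vec_wedge a1 b1 \<in> perp H"
    unfolding wedge_in_perp_iff proj vs by (rule st)
  have push: "push (vec_wedge a1 b1) = ?\<eta>" by (simp only: push_wedge proj)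
  have nz: "?\<eta> \<noteq> 0" using dim by (simp only: dim_pair_eq_2_iff not_False_eq_True)
  then have nz1: "vec_wedge a1 b1 \<noteq> 0" using push push_linear(3) by metis
  have "cvs.span {a1, b1} \<in> gr 2 UNIV"
    using nz1 dim_pair_eq_2_iff[of a1 b1] by (simp add: gr_def cvs.dim_span del: One_nat_def)
  then have "cvs.span {vec_wedge a1 b1} \<in> pluecker (gr 2 UNIV)"
    unfolding pluecker_def by blast
  moreover have "cvs.subspace (perp H)"
    unfolding perp_def
    using subspace_ext2[of "UNIV :: 'v set"] by (auto simp: cvs.subspace_def)
  then have "cvs.span {vec_wedge a1 b1} \<subseteq> perp H"
    using perp by (intro cvs.span_minimal) auto
  then have "cvs.span {vec_wedge a1 b1} \<in> proj_space (perp H)"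
    using cvs.dim_eq_card_independent[of "{vec_wedge a1 b1}"] nz1
    by (simp add: gr_def cvs.dim_span)
  ultimately have "cvs.span {vec_wedge a1 b1} \<in> linear_section H"
    unfolding linear_section_def by blast
  moreover have "push ` cvs.span {vec_wedge a1 b1} = m"
    unfolding push_span push m ..
  ultimately show ?thesis by blast
qed

lemma projectively_equivalent_section:
  "projectively_equivalent (perp H) (linear_section H)
     (ext2 W) (pluecker (Y_planes W (transpose_morphism W v \<omega>)))"
  unfolding projectively_equivalent_def
proof (intro exI conjI)
  show "linear_on (perp H) (ext2 W) push"
    using push_linear push_in_ext2 perp_iff by (auto simp only: linear_on_def)
  show "bij_betw push (perp H) (ext2 W)" by (rule bij_push)
  show "(\<lambda>l. push ` l) ` linear_section H = pluecker (Y_planes W (transpose_morphism W v \<omega>))"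
    using push_linear_section lift_Y_planes by blast
qed

end

end

theorem theorem3p1:
  fixes n :: nat
    and W :: "'v::complex_vector set"
    and v :: 'v
    and vstar :: "'v \<Rightarrow> complex"
  assumes "n \<ge> 1"
    and "cvs.dim (UNIV :: 'v set) = n + 3"
    and "cvs.subspace W"
    and "cvs.dim W = n + 2"
    and "W \<inter> cvs.span {v} = {0}"
    and "{w + x | w x. w \<in> W \<and> x \<in> cvs.span {v}} = UNIV"
    and "vstar \<in> dual"
    and "{x. vstar x = 0} = W"
    and "vstar v = 1"
  shows "\<exists>U. zariski_open (n + 2) (ext2_forms (dual :: ('v \<Rightarrow> complex) set)) U \<and> U \<noteq> {} \<and>
    (\<forall>H\<in>U. (\<exists>!\<omega>. assoc_morphism v vstar H \<omega>) \<and>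
      (\<forall>\<omega>. assoc_morphism v vstar H \<omega> \<longrightarrow>
        projectively_equivalent
          (perp H) (linear_section H)
          (ext2 W) (pluecker (Y_planes W (transpose_morphism W v \<omega>)))))"
proof -
  obtain B where B: "B \<subseteq> W" "cvs.independent B" "W \<subseteq> cvs.span B" "card B = n + 2"
    using cvs.basis_exists[of W] assms(4) by metis
  then have "finite B" by (intro card_ge_0_finite) simp
  then obtain e where e: "bij_betw e {0..<n + 2} B"
    using ex_bij_betw_nat_finite[of B] B(4) by metis
  then have eB: "e ` {..<n + 2} = B" "inj_on e {..<n + 2}"
    by (auto simp: bij_betw_def lessThan_atLeast0)
  have "cvs.span B = W"
    using B assms(3) by (intro equalityI cvs.span_minimal) auto
  with eB B(2) interpret hyperplane_splitting W v vstar e "n + 2"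
    using assms(7-9) by unfold_locales auto
  show ?thesis
    using zariski_open_transversal transversal_nonempty transversal_assoc_morphism_ex1
      projectively_equivalent_section
    by (intro exI[of _ transversal]) blast
qed

end
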